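(* Let $U$ be a nonempty bounded open subset of $\mathbb{R}^d$ and let $(X_n)_{n\ge1}$ be a sequence of independent random points, each uniformly distributed in $U$ (i.e. with law $\mathcal{L}^d(\cdot\cap U)/\mathcal{L}^d(U)$). Then, with probability one, $(X_n)_{n\ge1}$ is uniformly eutaxic in $U$.
   Context: Fix a norm $|\cdot|$ on $\mathbb{R}^d$; $\mathcal{L}^d$ is Lebesgue measure. $\mathrm{P}_d$ is the set of real sequences $(r_n)_{n\ge1}$ with $r_{n+1}\le r_n$, $r_n\to0$ and $\sum_nr_n^d=\infty$. A sequence $(x_n)$ in $\mathbb{R}^d$ is uniformly eutaxic in $U$ if for every $(r_n)\in\mathrm{P}_d$, $\mathcal{L}^d$-almost every $x\in U$ satisfies $|x-x_n|<r_n$ for infinitely many $n$. *)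

theory Defs
  imports "HOL-Probability.Probability"
begin

definition is_norm_fun :: "('a::real_vector \<Rightarrow> real) \<Rightarrow> bool" where
  "is_norm_fun N \<longleftrightarrow>
     (\<forall>x. 0 \<le> N x) \<and> (\<forall>x. N x = 0 \<longleftrightarrow> x = 0) \<and>
     (\<forall>c x. N (c *\<^sub>R x) = \<bar>c\<bar> * N x) \<and> (\<forall>x y. N (x + y) \<le> N x + N y)"

text \<open>The class P_d of radius sequences (indexed from 0 instead of 1).\<close>
definition P_seq :: "nat \<Rightarrow> (nat \<Rightarrow> real) set" where
  "P_seq d = {r. (\<forall>n. r (Suc n) \<le> r n) \<and> r \<longlonglongrightarrow> 0 \<and> \<not> summable (\<lambda>n. r n ^ d)}"

definition uniformly_eutaxic ::
  "('a::euclidean_space \<Rightarrow> real) \<Rightarrow> 'a set \<Rightarrow> (nat \<Rightarrow> 'a) \<Rightarrow> bool" where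
  "uniformly_eutaxic N U x \<longleftrightarrow>
     (\<forall>r\<in>P_seq DIM('a). AE y in lebesgue. y \<in> U \<longrightarrow> (\<exists>\<^sub>\<infinity>n. N (y - x n) < r n))"

end

theory Submission
  imports Defs
begin

text \<open>
  Cut space into dyadic cells of side \<open>2 ^ -j\<close>. By a union bound and Borel--Cantelli, almost surely
  for each finite union \<open>W\<close> of cells inside \<open>U\<close> and all large \<open>j\<close>, the first \<open>C * 2 ^ (j * d)\<close> points
  meet at least half of the cells of generation \<open>j\<close> in \<open>W\<close>. This is a countable family of
  conditions that does not mention the radii, and it implies eutaxy for all radii at once: choose one
  point per occupied cell and put a ball of radius \<open>\<rho> j = r (C * 2 ^ (j * d))\<close> around it. Since the chosen
  points are spread out, the overlaps of these balls are controlled, and the second moment method shows that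
  the balls of the generations beyond any given one cover a fixed proportion of \<open>W\<close>, as
  \<open>\<Sum>j. 2 ^ (j * d) * \<rho> j ^ d\<close> diverges by condensation.
\<close>

subsection \<open>Dyadic cells\<close>

text \<open>A cell is handled through its label, the integer vector of floors: the cell is the fibre
  of \<open>grid j\<close> over the label, and a union of cells is the preimage of a set of labels.
  Counting cells then means taking cardinalities of images.\<close>

definition grid :: "nat \<Rightarrow> 'a::euclidean_space \<Rightarrow> 'a" where
  "grid j y = (\<Sum>i\<in>Basis. of_int \<lfloor>2 ^ j * (y \<bullet> i)\<rfloor> *\<^sub>R i)"

lemma grid_inner: "i \<in> Basis \<Longrightarrow> grid j y \<bullet> i = of_int \<lfloor>2 ^ j * (y \<bullet> i)\<rfloor>"
  by (simp add: grid_def inner_sum_left inner_Basis if_distrib cong: if_cong)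

lemma grid_eq_iff:
  "grid j x = grid j y \<longleftrightarrow> (\<forall>i\<in>Basis. \<lfloor>2 ^ j * (x \<bullet> i)\<rfloor> = \<lfloor>2 ^ j * (y \<bullet> i)\<rfloor>)"
  by (subst euclidean_eq_iff) (simp add: grid_inner)

text \<open>A coarse floor is the integer quotient of the fine one by \<open>2 ^ (j - k)\<close>, so
  the dyadic cells are nested.\<close>

lemma grid_coarsen:
  assumes "k \<le> j" "grid j x = grid j y"
  shows "grid k x = grid k y"
proof -
  have "\<lfloor>2 ^ k * t\<rfloor> = \<lfloor>2 ^ j * t\<rfloor> div 2 ^ (j - k)" for t :: real
  proof -
    have "(2::real) ^ j = 2 ^ k * 2 ^ (j - k)"
      using assms(1) by (simp flip: power_add)
    then have "2 ^ k * t = (2 ^ j * t) / real_of_int (2 ^ (j - k))"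
      by simp
    then show ?thesis
      using floor_divide_real_eq_div[of "2 ^ (j - k)" "2 ^ j * t"] by simp
  qed
  with assms(2) show ?thesis
    by (simp add: grid_eq_iff)
qed

lemma grid_eq_imp_norm_le:
  fixes x y :: "'a::euclidean_space"
  assumes "grid j x = grid j y"
  shows "norm (x - y) \<le> DIM('a) / 2 ^ j"
proof -
  have "\<bar>(x - y) \<bullet> i\<bar> \<le> 1 / 2 ^ j" if "i \<in> Basis" for i
  proof -
    have "\<lfloor>2 ^ j * (x \<bullet> i)\<rfloor> = \<lfloor>2 ^ j * (y \<bullet> i)\<rfloor>"
      using assms that by (simp add: grid_eq_iff)
    then have "\<bar>2 ^ j * (x \<bullet> i) - 2 ^ j * (y \<bullet> i)\<bar> \<le> 1"
      by linarith
    then have "2 ^ j * \<bar>(x - y) \<bullet> i\<bar> \<le> 1"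
      by (simp add: inner_diff_left abs_mult flip: right_diff_distrib)
    then show ?thesis
      by (simp add: field_simps)
  qed
  then have "(\<Sum>i\<in>Basis. \<bar>(x - y) \<bullet> i\<bar>) \<le> (\<Sum>i\<in>(Basis::'a set). 1 / 2 ^ j)"
    by (intro sum_mono)
  with norm_le_l1[of "x - y"] show ?thesis
    by simp
qed

lemma grid_measurable [measurable]: "grid j \<in> borel_measurable borel"
  unfolding grid_def by measurable

lemma grid_vimage_borel: "finite F \<Longrightarrow> grid j -` F \<in> sets borel"
  using measurable_sets[OF grid_measurable, of F j] by (auto simp: finite_imp_closed)

text \<open>In each coordinate the floors lie in an integer interval whose size is at most the
  scaled length \<open>2 * s * 2 ^ j\<close>, plus one for rounding and one for counting both ends.
  The labels lie in the product of these intervals.\<close>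

lemma card_grid_image_le:
  fixes p :: "'a::euclidean_space" and s :: real
  assumes S: "\<And>x i. x \<in> S \<Longrightarrow> i \<in> Basis \<Longrightarrow> \<bar>x \<bullet> i - p \<bullet> i\<bar> \<le> s" and "0 \<le> s"
  shows "finite (grid j ` S)" "card (grid j ` S) \<le> (2 * s * 2 ^ j + 2) ^ DIM('a)"
proof -
  define Z where "Z i = {\<lfloor>2 ^ j * (p \<bullet> i - s)\<rfloor> .. \<lfloor>2 ^ j * (p \<bullet> i + s)\<rfloor>}" for i
  define h where "h f = (\<Sum>i\<in>Basis. of_int (f i) *\<^sub>R i)" for f :: "'a \<Rightarrow> int"
  have sub: "grid j ` S \<subseteq> h ` PiE Basis Z"
  proof
    fix z assume "z \<in> grid j ` S"
    then obtain x where x: "x \<in> S" "z = grid j x" by auto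
    define f where "f = restrict (\<lambda>i. \<lfloor>2 ^ j * (x \<bullet> i)\<rfloor>) Basis"
    have "z = h f"
      unfolding x h_def grid_def f_def by (intro sum.cong) auto
    moreover have "\<lfloor>2 ^ j * (x \<bullet> i)\<rfloor> \<in> Z i" if "i \<in> Basis" for i
    proof -
      have "p \<bullet> i - s \<le> x \<bullet> i" "x \<bullet> i \<le> p \<bullet> i + s"
        using S[OF x(1) that] by linarith+
      then show ?thesis
        unfolding Z_def by (auto intro!: floor_mono mult_left_mono)
    qed
    ultimately show "z \<in> h ` PiE Basis Z"
      by (auto simp: f_def)
  qed
  have fin: "finite (PiE Basis Z)"
    by (intro finite_PiE) (auto simp: Z_def)
  show "finite (grid j ` S)"
    using finite_subset[OF sub] fin by auto
  have card_Z: "real (card (Z i)) \<le> 2 * s * 2 ^ j + 2" for i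
  proof -
    have "0 \<le> 2 * s * 2 ^ j"
      using \<open>0 \<le> s\<close> by simp
    moreover have "2 ^ j * (p \<bullet> i + s) - 2 ^ j * (p \<bullet> i - s) = 2 * s * 2 ^ j"
      by (simp add: algebra_simps)
    ultimately show ?thesis
      unfolding Z_def card_atLeastAtMost_int by linarith
  qed
  have "card (grid j ` S) \<le> card (PiE Basis Z)"
    using surj_card_le[OF fin sub] .
  also have "\<dots> = (\<Prod>i\<in>Basis. card (Z i))"
    by (simp add: card_PiE)
  finally have "real (card (grid j ` S)) \<le> (\<Prod>i\<in>Basis. real (card (Z i)))"
    by (simp flip: of_nat_prod)
  also have "\<dots> \<le> (\<Prod>i\<in>(Basis::'a set). 2 * s * 2 ^ j + 2)"
    by (intro prod_mono) (auto simp: card_Z)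
  finally show "card (grid j ` S) \<le> (2 * s * 2 ^ j + 2) ^ DIM('a)"
    by simp
qed

lemma finite_grid_image:
  assumes "bounded W"
  shows "finite (grid j ` W)"
proof -
  obtain a where a: "\<And>x. x \<in> W \<Longrightarrow> norm x \<le> a"
    using assms unfolding bounded_iff by auto
  show ?thesis
  proof (rule card_grid_image_le(1)[where p = 0 and s = "\<bar>a\<bar>"])
    show "\<bar>x \<bullet> i - 0 \<bullet> i\<bar> \<le> \<bar>a\<bar>" if "x \<in> W" "i \<in> Basis" for x i
      using a[OF that(1)] Basis_le_norm[OF that(2), of x] by simp
  qed auto
qed

lemma countable_range_grid: "countable (range (grid j :: 'a::euclidean_space \<Rightarrow> 'a))"
proof -
  have "range (grid j :: 'a \<Rightarrow> 'a) \<subseteq> (\<Union>n. grid j ` cball 0 (real n))"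
  proof
    fix z :: 'a assume "z \<in> range (grid j)"
    then obtain x where "z = grid j x"
      by auto
    moreover obtain n where "norm x \<le> real n"
      using real_arch_simple by blast
    ultimately have "z \<in> grid j ` cball 0 (real n)"
      by (intro image_eqI[of _ _ x]) auto
    then show "z \<in> (\<Union>n. grid j ` cball 0 (real n))"
      by blast
  qed
  moreover have "countable (\<Union>n. grid j ` cball (0::'a) (real n))"
    by (intro countable_UN[OF countableI_type countable_finite] finite_grid_image bounded_cball)
  ultimately show ?thesis
    by (rule countable_subset)
qed

lemma bounded_grid_vimage:
  fixes F :: "'a::euclidean_space set"
  assumes "finite F"
  shows "bounded (grid k -` F)"
proof -
  have "bounded (grid k -` {z})" for z :: 'a
  proof (cases "\<exists>x. grid k x = z")
    case True
    then obtain x where "grid k x = z" by auto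
    then have "grid k -` {z} \<subseteq> cball x (DIM('a) / 2 ^ k)"
      by (auto simp: dist_norm intro!: grid_eq_imp_norm_le)
    then show ?thesis
      using bounded_cball bounded_subset by blast
  next
    case False
    then have "grid k -` {z} = {}" by auto
    then show ?thesis by simp
  qed
  moreover have "grid k -` F = (\<Union>z\<in>F. grid k -` {z})"
    by auto
  ultimately show ?thesis
    using assms by (metis bounded_UN)
qed

lemma emeasure_cell:
  fixes x :: "'a::euclidean_space"
  shows "emeasure lborel (grid j -` {grid j x}) = ennreal (1 / (2 ^ j) ^ DIM('a))"
proof -
  define l where "l = grid j x /\<^sub>R 2 ^ j"
  define u where "u = l + (\<Sum>i\<in>Basis. (1 / 2 ^ j) *\<^sub>R i)"
  have li: "l \<bullet> i = real_of_int \<lfloor>2 ^ j * (x \<bullet> i)\<rfloor> / 2 ^ j" if "i \<in> Basis" for i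
    using that by (simp add: l_def grid_inner divide_inverse_commute)
  have ui: "u \<bullet> i = l \<bullet> i + 1 / 2 ^ j" if "i \<in> Basis" for i
    using that by (simp add: u_def inner_add_left inner_sum_left inner_Basis if_distrib cong: if_cong)
  have cell: "y \<in> grid j -` {grid j x} \<longleftrightarrow> (\<forall>i\<in>Basis. l \<bullet> i \<le> y \<bullet> i \<and> y \<bullet> i < u \<bullet> i)" for y
  proof -
    have "\<lfloor>2 ^ j * (y \<bullet> i)\<rfloor> = \<lfloor>2 ^ j * (x \<bullet> i)\<rfloor> \<longleftrightarrow> l \<bullet> i \<le> y \<bullet> i \<and> y \<bullet> i < u \<bullet> i"
      if "i \<in> Basis" for i
      unfolding floor_eq_iff ui[OF that] li[OF that] by (auto simp: field_simps)
    then show ?thesis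
      by (simp add: grid_eq_iff)
  qed
  have lu: "l \<bullet> i \<le> u \<bullet> i" if "i \<in> Basis" for i
    using that by (simp add: ui)
  have "(\<Prod>i\<in>Basis. (u - l) \<bullet> i) = (\<Prod>i\<in>(Basis::'a set). 1 / 2 ^ j)"
    by (intro prod.cong) (auto simp: inner_diff_left ui)
  then have *: "(\<Prod>i\<in>Basis. (u - l) \<bullet> i) = 1 / (2 ^ j) ^ DIM('a)"
    by (simp add: power_divide)
  \<comment> \<open>The cell is half-open; it is squeezed between an open and a closed box of equal
    volume.\<close>
  have "grid j -` {grid j x} \<subseteq> cbox l u" "box l u \<subseteq> grid j -` {grid j x}"
    unfolding subset_iff cell by (auto simp: cbox_def box_def less_imp_le)
  then have "emeasure lborel (grid j -` {grid j x}) \<le> emeasure lborel (cbox l u)"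
    "emeasure lborel (box l u) \<le> emeasure lborel (grid j -` {grid j x})"
    by (intro emeasure_mono; simp add: grid_vimage_borel)+
  with lu * show ?thesis
    by simp
qed

lemma grid_vimage_measure:
  fixes F :: "'a::euclidean_space set"
  assumes "F \<subseteq> range (grid j)" "finite F"
  shows "measure lborel (grid j -` F) = card F / (2 ^ j) ^ DIM('a)"
proof -
  have *: "emeasure lborel (grid j -` {z}) = ennreal (1 / (2 ^ j) ^ DIM('a))" if "z \<in> F" for z
    using that assms(1) emeasure_cell by force
  have "measure lborel (\<Union>z\<in>F. grid j -` {z}) = (\<Sum>z\<in>F. measure lborel (grid j -` {z}))"
    using assms(2) by (intro measure_finite_Union)
      (auto simp: disjoint_family_on_def grid_vimage_borel * simp del: vimage_singleton_eq)
  also have "\<dots> = (\<Sum>z\<in>F. 1 / (2 ^ j) ^ DIM('a))"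
    by (intro sum.cong) (simp_all add: measure_def *)
  also have "(\<Union>z\<in>F. grid j -` {z}) = grid j -` F"
    by auto
  finally show ?thesis
    by simp
qed

lemma grid_vimage_refine:
  assumes "k \<le> j"
  shows "grid j -` (grid j ` (grid k -` F)) = grid k -` F"
  using grid_coarsen[OF assms] by (auto simp: image_iff)

text \<open>Since cells are nested, refining a union of cells of generation \<open>k\<close> leaves
  no partial cells, so the count is exact.\<close>

lemma grid_vimage_card:
  fixes F :: "'a::euclidean_space set"
  assumes "k \<le> j" "finite F"
  shows "real (card (grid j ` (grid k -` F))) = measure lborel (grid k -` F) * (2 ^ j) ^ DIM('a)"
proof -
  have "grid j ` (grid k -` F) \<subseteq> range (grid j)"
    by auto
  from grid_vimage_measure[OF this finite_grid_image[OF bounded_grid_vimage[OF assms(2)]]] show ?thesis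
    by (simp add: grid_vimage_refine[OF assms(1)])
qed

subsection \<open>Norms, second moments and condensation\<close>

lemma is_norm_fun_le_norm:
  fixes N :: "'a::euclidean_space \<Rightarrow> real"
  assumes "is_norm_fun N"
  obtains B where "B > 0" "\<And>x. N x \<le> B * norm x"
proof
  have tri: "N (x + y) \<le> N x + N y" and sc: "N (c *\<^sub>R x) = \<bar>c\<bar> * N x" and nn: "0 \<le> N x" for x y c
    using assms by (auto simp: is_norm_fun_def)
  have N0: "N 0 = 0"
    using sc[of 0 0] by simp
  have sum: "N (\<Sum>i\<in>I. f i) \<le> (\<Sum>i\<in>I. N (f i))" if "finite I" for I and f :: "'a \<Rightarrow> 'a"
    using that by (induction I) (auto simp: N0 intro: order_trans[OF tri])
  let ?B = "1 + (\<Sum>i\<in>(Basis::'a set). N i)"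
  show "?B > 0"
    using sum_nonneg[of Basis N] nn by (simp add: add_pos_nonneg)
  show "N x \<le> ?B * norm x" for x
  proof -
    have "N x = N (\<Sum>i\<in>Basis. (x \<bullet> i) *\<^sub>R i)"
      by (simp add: euclidean_representation)
    also have "\<dots> \<le> (\<Sum>i\<in>Basis. \<bar>x \<bullet> i\<bar> * N i)"
      using sum[of Basis "\<lambda>i. (x \<bullet> i) *\<^sub>R i"] by (simp add: sc)
    also have "\<dots> \<le> (\<Sum>i\<in>Basis. norm x * N i)"
      by (intro sum_mono mult_right_mono) (auto simp: Basis_le_norm nn)
    also have "\<dots> \<le> ?B * norm x"
      by (simp add: algebra_simps sum_distrib_left)
    finally show ?thesis .
  qed
qed

lemma is_norm_fun_continuous:
  fixes N :: "'a::euclidean_space \<Rightarrow> real"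
  assumes "is_norm_fun N"
  shows "continuous_on S N"
proof -
  obtain B where B: "B > 0" "\<And>x. N x \<le> B * norm x"
    using is_norm_fun_le_norm[OF assms] by blast
  have tri: "N (x + y) \<le> N x + N y" for x y
    using assms by (auto simp: is_norm_fun_def)
  have "\<bar>N x - N y\<bar> \<le> B * norm (x - y)" for x y
    using tri[of y "x - y"] tri[of x "y - x"] B(2)[of "x - y"] B(2)[of "y - x"]
    by (simp add: norm_minus_commute)
  then have "B-lipschitz_on S N"
    using B(1) by (intro lipschitz_onI) (auto simp: dist_norm)
  then show ?thesis
    by (rule lipschitz_on_continuous_on)
qed

text \<open>By compactness of the Euclidean unit sphere, \<open>N\<close> has a positive minimum
  there, and homogeneity carries the bound to all vectors. It later keeps balls for \<open>N\<close>
  inside Euclidean neighbourhoods.\<close>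

lemma norm_le_is_norm_fun:
  fixes N :: "'a::euclidean_space \<Rightarrow> real"
  assumes "is_norm_fun N"
  obtains A where "A > 0" "\<And>x. norm x \<le> A * N x"
proof -
  have sc: "N (c *\<^sub>R x) = \<bar>c\<bar> * N x" and nn: "0 \<le> N x" and z: "N x = 0 \<longleftrightarrow> x = 0" for x c
    using assms by (auto simp: is_norm_fun_def)
  have "compact (sphere (0::'a) 1)" "sphere (0::'a) 1 \<noteq> {}"
    by auto
  then obtain u where u: "u \<in> sphere 0 1" "\<And>y. y \<in> sphere 0 1 \<Longrightarrow> N u \<le> N y"
    using continuous_attains_inf[OF _ _ is_norm_fun_continuous[OF assms]] by metis
  have "N u \<noteq> 0"
    using u(1) z[of u] by auto
  then have pos: "N u > 0"
    using nn[of u] by simp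
  show thesis
  proof
    show "1 / N u > 0"
      using pos by simp
    show "norm x \<le> 1 / N u * N x" for x
    proof (cases "x = 0")
      case False
      then have "N u \<le> N (x /\<^sub>R norm x)"
        by (intro u(2)) auto
      then have "N u \<le> N x / norm x"
        using sc[of "inverse (norm x)" x] by (simp add: field_simps)
      with False pos show ?thesis
        by (simp add: field_simps)
    qed (simp add: nn)
  qed
qed

definition nball :: "('a::euclidean_space \<Rightarrow> real) \<Rightarrow> 'a \<Rightarrow> real \<Rightarrow> 'a set" where
  "nball N p s = {y. N (y - p) < s}"

context
  fixes N :: "'a::euclidean_space \<Rightarrow> real"
  assumes N: "is_norm_fun N"
begin

lemma open_nball: "open (nball N p s)"
  unfolding nball_def
  by (intro open_Collect_less continuous_intros continuous_on_compose2[OF is_norm_fun_continuous[OF N, of UNIV]]) auto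

lemma nball_fmeasurable: "nball N p s \<in> fmeasurable lborel"
proof -
  obtain A where A: "A > 0" "\<And>x. norm x \<le> A * N x"
    using norm_le_is_norm_fun[OF N] by blast
  have "nball N p s \<subseteq> cball p (A * s)"
  proof
    fix y assume "y \<in> nball N p s"
    then have "A * N (y - p) \<le> A * s"
      using A(1) by (simp add: nball_def)
    with A(2)[of "y - p"] show "y \<in> cball p (A * s)"
      by (simp add: dist_norm norm_minus_commute)
  qed
  moreover have "cball p (A * s) \<in> fmeasurable lborel"
    by (intro fmeasurableI emeasure_lborel_cball_finite) simp
  ultimately show ?thesis
    using open_nball[of p s] by (auto intro: fmeasurableI2[of "cball p (A * s)"])
qed

lemma measure_nball:
  assumes "s > 0"
  shows "measure lborel (nball N p s) = s ^ DIM('a) * measure lborel (nball N 0 1)"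
proof -
  have sc: "N (c *\<^sub>R x) = \<bar>c\<bar> * N x" for x c
    using N by (auto simp: is_norm_fun_def)
  have *: "nball N p s = (+) p ` ((*\<^sub>R) s ` nball N 0 1)"
  proof (intro set_eqI iffI)
    fix y assume "y \<in> nball N p s"
    then have "N ((1 / s) *\<^sub>R (y - p)) < 1"
      using assms by (simp add: nball_def sc)
    moreover have "y = p + s *\<^sub>R ((1 / s) *\<^sub>R (y - p))"
      using assms by simp
    ultimately show "y \<in> (+) p ` ((*\<^sub>R) s ` nball N 0 1)"
      by (auto simp: nball_def image_image intro!: image_eqI[of y _ "(1 / s) *\<^sub>R (y - p)"])
  qed (use assms in \<open>auto simp: nball_def sc\<close>)
  have "measure lebesgue (nball N p s) = s ^ DIM('a) * measure lebesgue (nball N 0 1)"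
    using measure_lebesgue_affine[of s p "nball N 0 1"] assms
    unfolding * image_image by (simp add: add.commute)
  then show ?thesis
    using open_nball by simp
qed

lemma measure_unit_nball_pos: "measure lborel (nball N 0 1) > 0"
proof -
  obtain B where B: "B > 0" "\<And>x. N x \<le> B * norm x"
    using is_norm_fun_le_norm[OF N] by blast
  have sub: "ball 0 (1 / B) \<subseteq> nball N 0 1"
  proof
    fix y :: 'a assume "y \<in> ball 0 (1 / B)"
    then have "B * norm y < 1"
      using B(1) by (simp add: field_simps)
    with B(2)[of y] show "y \<in> nball N 0 1"
      by (simp add: nball_def)
  qed
  have "0 < measure lborel (ball (0::'a) (1 / B))"
    using content_ball_pos[of "1 / B" "0::'a"] B(1) by simp
  also have "\<dots> \<le> measure lborel (nball N 0 1)"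
    by (intro measure_mono_fmeasurable sub nball_fmeasurable) auto
  finally show ?thesis .
qed

end

text \<open>Cauchy-Schwarz for two functions: the number of sets \<open>B a\<close> containing a
  point, and the indicator of their union, off which that number vanishes. It is derived from a
  nonnegative quadratic in \<open>t\<close>. Upper bounds on pairwise overlaps thus become a lower
  bound on the union.\<close>

lemma Chung_Erdos:
  assumes "finite I" and B: "\<And>a. a \<in> I \<Longrightarrow> B a \<in> fmeasurable M"
  shows "(\<Sum>a\<in>I. measure M (B a))\<^sup>2 \<le>
    measure M (\<Union>a\<in>I. B a) * (\<Sum>a\<in>I. \<Sum>b\<in>I. measure M (B a \<inter> B b))"
    (is "?s\<^sup>2 \<le> ?u * ?q")
proof -
  let ?U = "\<Union>a\<in>I. B a"
  have U: "?U \<in> fmeasurable M"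
    using assms by (intro fmeasurable.finite_UN) auto
  have BB: "B a \<inter> B b \<in> fmeasurable M" if "a \<in> I" "b \<in> I" for a b
    using that B by (intro fmeasurable.Int) auto
  have int: "integrable M (indicat_real S)" "integral\<^sup>L M (indicat_real S) = measure M S"
    if "S \<in> fmeasurable M" for S
    using that by (auto simp: fmeasurable_def)
  have "0 \<le> t\<^sup>2 * ?u - 2 * t * ?s + ?q" for t
  proof -
    let ?F = "\<lambda>x. \<Sum>a\<in>I. indicat_real (B a) x"
    have eq: "(t * indicat_real ?U x - ?F x)\<^sup>2 =
      t\<^sup>2 * indicat_real ?U x - 2 * t * ?F x + (\<Sum>a\<in>I. \<Sum>b\<in>I. indicat_real (B a \<inter> B b) x)" for x
    proof -
      have "(\<Sum>a\<in>I. \<Sum>b\<in>I. indicat_real (B a \<inter> B b) x) = ?F x * ?F x"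
        by (simp add: sum_product indicator_inter_arith)
      moreover have "indicat_real ?U x * ?F x = ?F x"
        by (auto simp: sum_distrib_left indicator_def intro!: sum.cong)
      moreover have "(indicat_real ?U x)\<^sup>2 = indicat_real ?U x"
        by (simp add: indicator_def)
      ultimately show ?thesis
        by (simp add: power2_diff power_mult_distrib power2_eq_square[of "?F x"] mult.assoc)
    qed
    have "0 \<le> (\<integral>x. (t * indicat_real ?U x - ?F x)\<^sup>2 \<partial>M)"
      by simp
    also have "\<dots> = t\<^sup>2 * ?u - 2 * t * ?s + ?q"
      unfolding eq using U B BB by (simp add: int)
    finally show ?thesis .
  qed note quad = this
  show ?thesis
  proof (cases "?u = 0")
    case True
    have "measure M (B a) \<le> ?u" if "a \<in> I" for a
      using that U B by (intro measure_mono_fmeasurable) (auto simp: fmeasurable_def)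
    then have "measure M (B a) = 0" if "a \<in> I" for a
      using that True by (simp add: measure_le_0_iff)
    then have "?s = 0"
      by simp
    then show ?thesis
      by (simp add: True)
  next
    case False
    then have "?u > 0"
      by (simp add: zero_less_measure_iff)
    \<comment> \<open>The value \<open>t = ?s / ?u\<close> minimises the quadratic.\<close>
    moreover have "(?s / ?u)\<^sup>2 * ?u - 2 * (?s / ?u) * ?s = - (?s\<^sup>2 / ?u)"
      using False by (simp add: power2_eq_square)
    then have "?s\<^sup>2 / ?u \<le> ?q"
      using quad[of "?s / ?u"] by linarith
    ultimately show ?thesis
      by (simp add: pos_divide_le_eq mult.commute)
  qed
qed

text \<open>Cauchy condensation in base \<open>b\<close> with blocks starting at \<open>C\<close>:
  from \<open>C * b ^ J\<close> up to \<open>C * b ^ Suc J\<close> a decreasing \<open>f\<close> is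
  at most its value at the left end, so a convergent condensed series would bound all partial sums
  of \<open>f\<close>. The indices below \<open>C\<close> cost at most
  \<open>C * f 0\<close>.\<close>

lemma not_summable_condense:
  fixes f :: "nat \<Rightarrow> real"
  assumes "antimono f" and nn: "\<And>n. 0 \<le> f n" and "\<not> summable f" and b: "b \<ge> 2" and C: "C \<ge> 1"
  shows "\<not> summable (\<lambda>j. real b ^ j * f (C * b ^ j))"
proof
  let ?g = "\<lambda>j. real b ^ j * f (C * b ^ j)"
  assume s: "summable ?g"
  have mono: "f n \<le> f m" if "m \<le> n" for m n
    using \<open>antimono f\<close> that by (auto dest: antimonoD)
  have bound: "sum f {..<C * b ^ J} \<le> C * f 0 + C * b * (\<Sum>j<J. ?g j)" for J
  proof (induction J)
    case 0
    have "sum f {..<C} \<le> (\<Sum>n<C. f 0)"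
      by (intro sum_mono mono) auto
    then show ?case by simp
  next
    case (Suc J)
    have le: "C * b ^ J \<le> C * b ^ Suc J"
      using b by simp
    have "sum f {C * b ^ J..<C * b ^ Suc J} \<le> (\<Sum>n\<in>{C * b ^ J..<C * b ^ Suc J}. f (C * b ^ J))"
      by (intro sum_mono mono) auto
    also have "\<dots> \<le> real (C * b ^ Suc J) * f (C * b ^ J)"
      by (auto intro!: mult_right_mono nn simp del: of_nat_mult)
    also have "\<dots> = C * b * ?g J"
      by (simp add: mult_ac)
    finally show ?case
      using Suc sum.atLeastLessThan_concat[OF le0 le, of f]
      by (simp add: distrib_left lessThan_atLeast0)
  qed
  have "summable f"
  proof (rule summableI_nonneg_bounded)
    fix n
    have "n < b ^ n"
      using b by (intro power_gt_expt) auto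
    also have "b ^ n \<le> C * b ^ n"
      using C by simp
    finally have "sum f {..<n} \<le> sum f {..<C * b ^ n}"
      by (intro sum_mono2) (auto simp: nn)
    also note bound[of n]
    also have "(\<Sum>j<n. ?g j) \<le> suminf ?g"
      using s nn by (intro sum_le_suminf) auto
    finally show "sum f {..<n} \<le> C * f 0 + C * b * suminf ?g"
      by (simp add: mult_left_mono)
  qed (rule nn)
  with \<open>\<not> summable f\<close> show False ..
qed

subsection \<open>Balls around one point per cell\<close>

text \<open>Only centres at \<open>N\<close>-distance less than \<open>2 * s\<close> from
  \<open>p\<close> contribute. They lie in distinct cells, so there are no more of them than cells
  meeting a cube of half-side \<open>2 * A * s\<close>, and each costs at most the volume of one
  ball of radius \<open>t\<close>. The summand \<open>1\<close> covers radii \<open>s\<close> below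
  the cell size.\<close>

lemma sum_nball_overlap_le:
  fixes N :: "'a::euclidean_space \<Rightarrow> real"
  assumes N: "is_norm_fun N" and A: "A > 0" "\<And>x. norm x \<le> A * N x"
    and Q: "finite Q" "inj_on (grid j) Q" and t: "0 < t" "t \<le> s"
  shows "(\<Sum>q\<in>Q. measure lborel (nball N p s \<inter> nball N q t)) \<le>
    ((8 * A) ^ DIM('a) + 4 ^ DIM('a)) * (1 + s ^ DIM('a) * (2 ^ j) ^ DIM('a)) *
    (t ^ DIM('a) * measure lborel (nball N 0 1))"
proof -
  let ?d = "DIM('a)"
  have tri: "N (x + y) \<le> N x + N y" and sym: "N (- x) = N x" for x y
    using N by (auto simp: is_norm_fun_def dest: spec[of _ "-1 :: real"])
  define Q' where "Q' = {q \<in> Q. N (q - p) < 2 * s}"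
  have empty: "nball N p s \<inter> nball N q t = {}" if "q \<in> Q - Q'" for q
  proof (rule ccontr)
    assume "nball N p s \<inter> nball N q t \<noteq> {}"
    then obtain y where "N (y - p) < s" "N (y - q) < t"
      by (auto simp: nball_def)
    then have "N (q - p) < 2 * s"
      using tri[of "y - p" "q - y"] sym[of "q - y"] t by simp
    with that show False
      by (simp add: Q'_def)
  qed
  have "(\<Sum>q\<in>Q. measure lborel (nball N p s \<inter> nball N q t)) =
      (\<Sum>q\<in>Q'. measure lborel (nball N p s \<inter> nball N q t))"
    using Q(1) by (intro sum.mono_neutral_right) (auto simp: empty, auto simp: Q'_def)
  also have "\<dots> \<le> (\<Sum>q\<in>Q'. measure lborel (nball N q t))"
    by (intro sum_mono measure_mono_fmeasurable nball_fmeasurable[OF N])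
      (auto simp: open_nball[OF N] borel_open)
  also have "\<dots> = card Q' * (t ^ ?d * measure lborel (nball N 0 1))"
    by (simp add: measure_nball[OF N t(1)])
  also have "\<dots> \<le> ((8 * A) ^ ?d + 4 ^ ?d) * (1 + s ^ ?d * (2 ^ j) ^ ?d) *
    (t ^ ?d * measure lborel (nball N 0 1))"
  proof (rule mult_right_mono)
    define u where "u = 2 * (2 * A * s) * 2 ^ j"
    have u0: "u \<ge> 0"
      using A t by (simp add: u_def)
    have "card Q' = card (grid j ` Q')"
      using Q(2) by (intro card_image[symmetric] inj_on_subset[OF Q(2)]) (auto simp: Q'_def)
    also have "real \<dots> \<le> (u + 2) ^ ?d"
      unfolding u_def
    proof (rule card_grid_image_le(2)[where p = p])
      fix x i :: 'a assume "x \<in> Q'" "i \<in> Basis"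
      then have "A * N (x - p) \<le> A * (2 * s)"
        using A by (intro mult_left_mono) (auto simp: Q'_def)
      with A(2)[of "x - p"] Basis_le_norm[OF \<open>i \<in> Basis\<close>, of "x - p"]
      show "\<bar>x \<bullet> i - p \<bullet> i\<bar> \<le> 2 * A * s"
        by (simp add: inner_diff_left)
    qed (use A t in auto)
    \<comment> \<open>Since \<open>u + 2\<close> is at most twice the larger of \<open>u\<close> and
      \<open>2\<close>, the power splits into a volume term and a constant.\<close>
    also have "(u + 2) ^ ?d \<le> (2 * u) ^ ?d + 4 ^ ?d"
    proof (cases "u \<le> 2")
      case True
      then have "(u + 2) ^ ?d \<le> 4 ^ ?d"
        using u0 by (intro power_mono) auto
      then show ?thesis
        using u0 by (simp add: add_increasing)
    next
      case False
      then have "(u + 2) ^ ?d \<le> (2 * u) ^ ?d"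
        using u0 by (intro power_mono) auto
      then show ?thesis
        by (simp add: add_increasing2)
    qed
    also have "(2 * u) ^ ?d = (8 * A) ^ ?d * (s ^ ?d * (2 ^ j) ^ ?d)"
    proof -
      have "2 * u = 8 * A * (s * 2 ^ j)"
        by (simp add: u_def)
      then show ?thesis
        by (simp only: power_mult_distrib)
    qed
    also have "(8 * A) ^ ?d * (s ^ ?d * (2 ^ j) ^ ?d) + 4 ^ ?d \<le>
        ((8 * A) ^ ?d + 4 ^ ?d) * (1 + s ^ ?d * (2 ^ j) ^ ?d)"
      using A t by (simp add: algebra_simps)
    finally show "real (card Q') \<le> ((8 * A) ^ ?d + 4 ^ ?d) * (1 + s ^ ?d * (2 ^ j) ^ ?d)" .
  qed (use t in auto)
  finally show ?thesis .
qed

lemma sum_geometric_le: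
  fixes b :: real
  assumes "b \<ge> 2"
  shows "(\<Sum>i\<le>j. b ^ i) \<le> 2 * b ^ j"
proof (induction j)
  case (Suc j)
  have "2 * b ^ j \<le> b * b ^ j"
    using assms by (intro mult_right_mono) auto
  with Suc show ?case
    by simp
qed simp

text \<open>Second moment method for all balls of generations \<open>m\<close> to \<open>n\<close>.
  With \<open>\<Sigma>\<close> the sum in the last hypothesis, the volumes add up to at least
  \<open>l * \<omega> * \<Sigma> / 2\<close>, while the overlaps add up to at most
  \<open>5 * l * D * \<omega> * \<Sigma>\<close> times \<open>\<Sigma>\<close>. The quotient no
  longer depends on the radii or on the range of generations.\<close>

lemma measure_Union_nball_ge:
  fixes N :: "'a::euclidean_space \<Rightarrow> real" and P :: "nat \<Rightarrow> 'a set" and \<beta> :: "nat \<Rightarrow> real" and m n :: nat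
  defines "\<beta> \<equiv> \<lambda>j. (2 ^ j) ^ DIM('a)"
  assumes N: "is_norm_fun N" and A: "A > 0" "\<And>x. norm x \<le> A * N x"
    and fin: "\<And>j. j \<in> {m..n} \<Longrightarrow> finite (P j)"
    and inj: "\<And>j. j \<in> {m..n} \<Longrightarrow> inj_on (grid j) (P j)"
    and lower: "\<And>j. j \<in> {m..n} \<Longrightarrow> l * \<beta> j \<le> 2 * card (P j)"
    and upper: "\<And>j. j \<in> {m..n} \<Longrightarrow> card (P j) \<le> l * \<beta> j"
    and \<rho>: "antimono \<rho>" "\<And>j. \<rho> j > 0"
    and S: "(\<Sum>j=m..n. \<beta> j * \<rho> j ^ DIM('a)) \<ge> 1"
  shows "l * measure lborel (nball N 0 1) \<le> 20 * ((8 * A) ^ DIM('a) + 4 ^ DIM('a)) *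
    measure lborel (\<Union>j\<in>{m..n}. \<Union>p\<in>P j. nball N p (\<rho> j))"
proof -
  let ?d = "DIM('a)"
  let ?J = "{m..n}"
  define D where "D = (8 * A) ^ ?d + 4 ^ ?d"
  define \<omega> where "\<omega> = measure lborel (nball N 0 1)"
  define a where "a j = \<beta> j * \<rho> j ^ ?d" for j
  define u where "u = measure lborel (\<Union>j\<in>?J. \<Union>p\<in>P j. nball N p (\<rho> j))"
  define G where "G i j = (\<Sum>p\<in>P i. \<Sum>q\<in>P j. measure lborel (nball N p (\<rho> i) \<inter> nball N q (\<rho> j)))" for i j
  \<comment> \<open>\<open>H\<close> carries the contribution of the summand \<open>1\<close> in the
    overlap bound. It is supported on \<open>i \<le> j\<close>, so that \<open>H i j + H j i\<close>
    serves both orders of a pair.\<close>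
  define H where "H i j = (if i \<le> j then \<beta> i * \<rho> j ^ ?d else 0)" for i j :: nat
  define \<Sigma> where "\<Sigma> = (\<Sum>j\<in>?J. a j)"
  have \<Sigma>: "\<Sigma> \<ge> 1"
    using S by (simp add: \<Sigma>_def a_def)
  have \<omega>: "\<omega> > 0"
    unfolding \<omega>_def by (rule measure_unit_nball_pos[OF N])
  have D: "D > 0"
    using A by (simp add: D_def add_pos_pos)
  have \<beta>: "\<beta> j > 0" for j
    by (simp add: \<beta>_def)
  have ne: "m \<le> n"
    using S by (cases "m \<le> n") simp_all
  have l: "l \<ge> 0"
  proof -
    have "0 \<le> l * \<beta> m"
      using upper[of m] ne by (auto intro: order_trans[OF of_nat_0_le_iff])
    then show ?thesis
      using \<beta>[of m] by (simp add: zero_le_mult_iff)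
  qed
  \<comment> \<open>For \<open>i \<le> j\<close> the earlier generation has the larger radius, so
    the overlap bound is applied around each point of \<open>P i\<close> to the smaller balls of
    generation \<open>j\<close>.\<close>
  have G_le: "G i j \<le> l * D * \<omega> * (\<beta> i * \<rho> j ^ ?d + a i * a j)" if ij: "i \<in> ?J" "j \<in> ?J" "i \<le> j" for i j
  proof -
    have "G i j \<le> (\<Sum>p\<in>P i. D * (1 + \<rho> i ^ ?d * \<beta> j) * (\<rho> j ^ ?d * \<omega>))"
      unfolding G_def D_def \<omega>_def \<beta>_def
      using ij \<rho> by (intro sum_mono sum_nball_overlap_le[OF N A] fin inj) (auto dest: antimonoD)
    also have "\<dots> = card (P i) * (D * (1 + \<rho> i ^ ?d * \<beta> j) * (\<rho> j ^ ?d * \<omega>))"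
      by simp
    also have "\<dots> \<le> (l * \<beta> i) * (D * (1 + \<rho> i ^ ?d * \<beta> j) * (\<rho> j ^ ?d * \<omega>))"
      using upper[OF ij(1)] D \<rho>(2)[of i] \<rho>(2)[of j] \<beta>[of j] \<omega>
      by (intro mult_right_mono) auto
    also have "\<dots> = l * D * \<omega> * (\<beta> i * \<rho> j ^ ?d + a i * a j)"
      by (simp add: a_def algebra_simps)
    finally show ?thesis .
  qed
  have G_sym: "G i j = G j i" for i j
    unfolding G_def by (subst sum.swap) (simp add: Int_commute)
  have H0: "0 \<le> H i j" for i j
    using \<beta>[of i] \<rho>(2)[of j] by (simp add: H_def)
  have G_all: "G i j \<le> l * D * \<omega> * (H i j + H j i + a i * a j)" if ij: "i \<in> ?J" "j \<in> ?J" for i j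
  proof -
    have *: "G i j \<le> l * D * \<omega> * (H i j + H j i + a i * a j)" if "i \<in> ?J" "j \<in> ?J" "i \<le> j" for i j
    proof -
      note G_le[OF that]
      also have "l * D * \<omega> * (\<beta> i * \<rho> j ^ ?d + a i * a j) \<le> l * D * \<omega> * (H i j + H j i + a i * a j)"
        using l D \<omega> H0[of j i] that(3) by (intro mult_left_mono) (auto simp: H_def)
      finally show ?thesis .
    qed
    show ?thesis
    proof (cases "i \<le> j")
      case False
      then show ?thesis
        using *[of j i] ij G_sym[of i j] by (simp add: add.commute mult.commute[of "a i"])
    qed (use * ij in auto)
  qed
  \<comment> \<open>For fixed \<open>j\<close> the cell numbers of earlier generations form a
    geometric sum with ratio at least 2, dominated by its last term. Hence this part is only linear
    in \<open>\<Sigma>\<close>.\<close>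
  have H_sum: "(\<Sum>i\<in>?J. \<Sum>j\<in>?J. H i j) \<le> 2 * \<Sigma>"
  proof -
    have "(\<Sum>i\<in>?J. H i j) \<le> 2 * a j" for j
    proof -
      have "(2::real) ^ 1 \<le> 2 ^ ?d"
        by (intro power_increasing) (auto simp: Suc_leI)
      then have b: "(2::real) ^ ?d \<ge> 2"
        by simp
      have \<beta>_eq: "\<beta> i = (2 ^ ?d) ^ i" for i
        by (simp add: \<beta>_def mult.commute flip: power_mult)
      have "(\<Sum>i\<in>?J. H i j) = (\<Sum>i\<in>?J \<inter> {..j}. \<beta> i * \<rho> j ^ ?d)"
        unfolding H_def by (subst sum.inter_restrict) auto
      also have "\<dots> \<le> (\<Sum>i\<le>j. \<beta> i * \<rho> j ^ ?d)"
        using \<beta> \<rho>(2)[of j] by (intro sum_mono2) (auto simp: less_imp_le)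
      also have "\<dots> = (\<Sum>i\<le>j. (2 ^ ?d) ^ i) * \<rho> j ^ ?d"
        by (simp add: \<beta>_eq sum_distrib_right)
      also have "\<dots> \<le> (2 * (2 ^ ?d) ^ j) * \<rho> j ^ ?d"
        using sum_geometric_le[OF b] \<rho>(2)[of j] by (intro mult_right_mono) auto
      finally show ?thesis
        by (simp add: a_def \<beta>_eq)
    qed
    then have "(\<Sum>j\<in>?J. \<Sum>i\<in>?J. H i j) \<le> (\<Sum>j\<in>?J. 2 * a j)"
      by (intro sum_mono)
    then show ?thesis
      by (subst sum.swap) (simp add: \<Sigma>_def sum_distrib_left)
  qed
  have "(\<Sum>i\<in>?J. \<Sum>j\<in>?J. G i j) \<le> (\<Sum>i\<in>?J. \<Sum>j\<in>?J. l * D * \<omega> * (H i j + H j i + a i * a j))"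
    by (intro sum_mono G_all)
  also have "\<dots> = l * D * \<omega> * (2 * (\<Sum>i\<in>?J. \<Sum>j\<in>?J. H i j) + \<Sigma> * \<Sigma>)"
  proof -
    have "(\<Sum>i\<in>?J. \<Sum>j\<in>?J. H j i) = (\<Sum>i\<in>?J. \<Sum>j\<in>?J. H i j)"
      by (rule sum.swap)
    moreover have "(\<Sum>i\<in>?J. \<Sum>j\<in>?J. a i * a j) = \<Sigma> * \<Sigma>"
      by (simp add: \<Sigma>_def sum_product)
    ultimately show ?thesis
      by (simp add: sum.distrib flip: sum_distrib_left)
  qed
  also have "\<dots> \<le> l * D * \<omega> * (5 * \<Sigma>\<^sup>2)"
  proof (rule mult_left_mono)
    \<comment> \<open>Here \<open>\<Sigma> \<ge> 1\<close> lets the quadratic term absorb the linear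
      one: \<open>4 * \<Sigma>\<close> plus the square is at most five squares.\<close>
    have "\<Sigma> \<le> \<Sigma> * \<Sigma>"
      using \<Sigma> by simp
    with H_sum show "2 * (\<Sum>i\<in>?J. \<Sum>j\<in>?J. H i j) + \<Sigma> * \<Sigma> \<le> 5 * \<Sigma>\<^sup>2"
      by (simp add: power2_eq_square)
  qed (use l D \<omega> in auto)
  finally have G_sum: "(\<Sum>i\<in>?J. \<Sum>j\<in>?J. G i j) \<le> l * D * \<omega> * (5 * \<Sigma>\<^sup>2)" .
  define I where "I = Sigma ?J P"
  define B where "B = (\<lambda>(j, p). nball N p (\<rho> j))"
  have finI: "finite I"
    unfolding I_def using fin by (intro finite_SigmaI) auto
  have sum_I: "(\<Sum>x\<in>I. f x) = (\<Sum>j\<in>?J. \<Sum>p\<in>P j. f (j, p))" for f :: "nat \<times> 'a \<Rightarrow> real"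
    unfolding I_def using fin by (subst sum.Sigma) auto
  have first: "l * \<omega> * \<Sigma> / 2 \<le> (\<Sum>x\<in>I. measure lborel (B x))"
  proof -
    have "l * \<omega> * \<Sigma> / 2 = (\<Sum>j\<in>?J. (l * \<beta> j / 2) * (\<rho> j ^ ?d * \<omega>))"
      by (simp add: \<Sigma>_def a_def sum_distrib_left sum_divide_distrib mult_ac)
    also have "\<dots> \<le> (\<Sum>j\<in>?J. card (P j) * (\<rho> j ^ ?d * \<omega>))"
      using lower \<omega> \<rho>(2) by (intro sum_mono mult_right_mono) (fastforce simp: less_imp_le)+
    also have "\<dots> = (\<Sum>x\<in>I. measure lborel (B x))"
      by (simp add: sum_I B_def measure_nball[OF N \<rho>(2)] \<omega>_def)
    finally show ?thesis .
  qed
  have second: "(\<Sum>x\<in>I. \<Sum>y\<in>I. measure lborel (B x \<inter> B y)) = (\<Sum>i\<in>?J. \<Sum>j\<in>?J. G i j)"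
    unfolding sum_I G_def B_def by (intro sum.cong refl) (simp add: sum.swap[of _ ?J])
  have "(\<Union>x\<in>I. B x) = (\<Union>j\<in>?J. \<Union>p\<in>P j. nball N p (\<rho> j))"
    by (auto simp: I_def B_def)
  then have CE: "(\<Sum>x\<in>I. measure lborel (B x))\<^sup>2 \<le> u * (\<Sum>i\<in>?J. \<Sum>j\<in>?J. G i j)"
    using Chung_Erdos[OF finI, of B lborel] second
    by (auto simp: u_def B_def nball_fmeasurable[OF N])
  have "(l * \<omega> * \<Sigma> / 2)\<^sup>2 \<le> (\<Sum>x\<in>I. measure lborel (B x))\<^sup>2"
    using l \<omega> \<Sigma> by (intro power_mono first) auto
  also note CE
  also have "u * (\<Sum>i\<in>?J. \<Sum>j\<in>?J. G i j) \<le> u * (l * D * \<omega> * (5 * \<Sigma>\<^sup>2))"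
    by (intro mult_left_mono G_sum) (simp add: u_def)
  \<comment> \<open>The constant 20 is 4, from squaring the half in the first moment, times 5 from
    the overlaps. Cancelling the common factor requires \<open>l \<noteq> 0\<close>; for
    \<open>l = 0\<close> the claim is trivial.\<close>
  finally have "(l * \<omega> * \<Sigma>\<^sup>2) * (l * \<omega>) \<le> (l * \<omega> * \<Sigma>\<^sup>2) * (20 * D * u)"
    by (simp add: power2_eq_square algebra_simps)
  moreover have "0 < l * \<omega> * \<Sigma>\<^sup>2" if "l \<noteq> 0"
    using that l \<omega> \<Sigma> by simp
  moreover have "0 \<le> 20 * D * u"
    using D by (simp add: u_def)
  ultimately have "l * \<omega> \<le> 20 * D * u"
    by (cases "l = 0") (auto dest: mult_left_le_imp_le)
  then show ?thesis
    by (simp add: \<omega>_def D_def u_def)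
qed

subsection \<open>A criterion for uniform eutaxy\<close>

text \<open>By regularity of Lebesgue measure it suffices to hit every
  open set \<open>V\<close> in a fixed proportion, because the missed set can be enclosed in
  a \<open>V\<close> of almost the same measure.\<close>
lemma uniformly_eutaxic_if_half_occupied:
  fixes N :: "'a::euclidean_space \<Rightarrow> real"
  assumes N: "is_norm_fun N" and U: "open U" "bounded U" and C: "C \<ge> 1"
    and occ: "\<And>k F. finite F \<Longrightarrow> F \<subseteq> range (grid k) \<Longrightarrow> grid k -` F \<subseteq> U \<Longrightarrow>
      eventually (\<lambda>j. card (grid j ` (grid k -` F)) \<le>
        2 * card (grid j ` (x ` {..<C * (2 ^ DIM('a)) ^ j} \<inter> grid k -` F))) sequentially"
  shows "uniformly_eutaxic N U x"
  unfolding uniformly_eutaxic_def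
proof
  let ?d = "DIM('a)"
  fix r assume "r \<in> P_seq ?d"
  then have r: "antimono r" "r \<longlonglongrightarrow> 0" "\<not> summable (\<lambda>n. r n ^ ?d)"
    by (auto simp: P_seq_def decseq_Suc_iff)
  have r0: "r n \<ge> 0" for n
    using decseq_ge[OF r(1,2)] .
  \<comment> \<open>A zero radius would force all later radii to be zero and make the divergent
    series a finite sum. Positive radii are needed for the volume formula for balls.\<close>
  have rpos: "r n > 0" for n
  proof (rule ccontr)
    assume "\<not> r n > 0"
    then have "r i = 0" if "i \<ge> n" for i
      using antimonoD[OF r(1) that] r0[of i] by simp
    then have "summable (\<lambda>n. r n ^ ?d)"
      by (intro summable_finite[of "{..<n}"]) (auto simp: not_less)
    with r(3) show False ..
  qed
  obtain A where A: "A > 0" "\<And>x. norm x \<le> A * N x"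
    using norm_le_is_norm_fun[OF N] by blast

  \<comment> \<open>Radii along the dyadic generations\<close>
  define m where "m j = C * (2 ^ ?d) ^ j" for j
  \<comment> \<open>As \<open>r\<close> decreases, \<open>\<rho> j \<le> r n\<close> for every
    \<open>n < m j\<close>: a point in a ball of generation \<open>j\<close> is also within the
    original radius of that centre.\<close>
  define \<rho> where "\<rho> j = r (m j)" for j
  define \<beta> :: "nat \<Rightarrow> real" where "\<beta> j = (2 ^ j) ^ ?d" for j
  have m_mono: "m i \<le> m j" if "i \<le> j" for i j
    using that by (auto simp: m_def intro!: power_increasing)
  have m_ge: "j \<le> m j" for j
  proof -
    have "(2::nat) ^ 1 \<le> 2 ^ ?d"
      by (intro power_increasing) (auto simp: Suc_leI)
    then have "j < (2 ^ ?d) ^ j"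
      by (intro power_gt_expt) auto
    also have "\<dots> \<le> m j"
      using C by (simp add: m_def)
    finally show ?thesis
      by simp
  qed
  have \<rho>: "antimono \<rho>" "\<And>j. \<rho> j > 0"
    using antimonoD[OF r(1)] m_mono by (auto simp: \<rho>_def antimono_def rpos)
  have \<rho>_lim: "\<rho> \<longlonglongrightarrow> 0"
    unfolding \<rho>_def by (rule filterlim_compose[OF r(2)])
      (auto intro!: filterlim_at_top_mono[OF filterlim_ident] simp: m_ge)
  have div: "\<not> summable (\<lambda>j. \<beta> j * \<rho> j ^ ?d)"
  proof -
    have "(2::nat) ^ 1 \<le> 2 ^ ?d"
      by (intro power_increasing) (auto simp: Suc_leI)
    moreover have "antimono (\<lambda>n. r n ^ ?d)"
      using antimonoD[OF r(1)] r0 by (auto simp: antimono_def intro!: power_mono)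
    ultimately have "\<not> summable (\<lambda>j. real (2 ^ ?d) ^ j * r (C * (2 ^ ?d) ^ j) ^ ?d)"
      using not_summable_condense[of "\<lambda>n. r n ^ ?d" "2 ^ ?d" C] r(3) r0 C by simp
    moreover have "real (2 ^ ?d) ^ j = \<beta> j" for j
      by (simp add: \<beta>_def mult.commute flip: power_mult)
    ultimately show ?thesis
      by (simp add: \<rho>_def m_def)
  qed
  define R where "R i = (\<Union>j\<in>{i..}. \<Union>n<m j. nball N (x n) (\<rho> j))" for i
  have open_R: "open (R i)" for i
    unfolding R_def by (intro open_UN ballI open_nball[OF N])

  \<comment> \<open>The part of \<open>U\<close> missed by all generations from \<open>i\<close> on
    is null\<close>
  have null: "U - R i \<in> null_sets lborel" for i
  proof -
    define E where "E = U - R i"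
    have E_borel: "E \<in> sets borel"
      using U open_R by (simp add: E_def borel_open)
    have E_bounded: "bounded E"
      using U by (auto simp: E_def intro: bounded_subset)
    have E: "E \<in> lmeasurable"
      using E_borel E_bounded by (intro bounded_set_imp_lmeasurable) auto
    have "measure lebesgue E = 0"
    proof (rule ccontr)
      assume "measure lebesgue E \<noteq> 0"
      then have e: "measure lebesgue E > 0"
        by (simp add: zero_less_measure_iff)
      \<comment> \<open>Inner regularity with the measure of \<open>E\<close> itself as tolerance
        leaves a \<open>K\<close> of positive measure, which is compact because \<open>E\<close> is
        bounded.\<close>
      then obtain K where K: "closed K" "K \<subseteq> E" "E - K \<in> lmeasurable"
          "emeasure lebesgue (E - K) < ennreal (measure lebesgue E)"
        using sets_lebesgue_inner_closed[of E "measure lebesgue E"] E_borel by auto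
      have "compact K"
        using K E_bounded by (auto simp: compact_eq_bounded_closed intro: bounded_subset)
      have K_meas: "K \<in> lmeasurable"
        using \<open>compact K\<close> by (rule lmeasurable_compact)
      have K_pos: "measure lebesgue K > 0"
      proof -
        have "measure lebesgue (E - K) < measure lebesgue E"
          using K(3,4) by (simp add: emeasure_eq_measure2 ennreal_less_iff)
        then show ?thesis
          using measurable_measure_Diff[OF E _ K(2)] K_meas by (auto dest: fmeasurableD)
      qed
      define \<omega> where "\<omega> = measure lborel (nball N 0 1)"
      define D where "D = 20 * ((8 * A) ^ ?d + 4 ^ ?d)"
      have D: "D > 0"
        using A by (simp add: D_def add_pos_pos)
      have \<omega>: "\<omega> > 0"
        unfolding \<omega>_def by (rule measure_unit_nball_pos[OF N])
      \<comment> \<open>The tolerance is the proportion of \<open>K\<close> that the second moment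
        bound forces the balls to cover. The balls will lie in \<open>T\<close> and miss
        \<open>K\<close>, so \<open>T - K\<close> would have to be at least that large.\<close>
      obtain T where T: "open T" "K \<subseteq> T" "T - K \<in> lmeasurable"
          "emeasure lebesgue (T - K) < ennreal (\<omega> / D * measure lebesgue K)"
        using sets_lebesgue_outer_open[of K "\<omega> / D * measure lebesgue K"] K_meas K_pos \<omega> D
        by (auto dest: fmeasurableD)
      have TK: "measure lebesgue (T - K) < \<omega> / D * measure lebesgue K"
        using T(3,4) \<omega> D by (simp add: emeasure_eq_measure2 ennreal_less_iff)
      have "K \<subseteq> T \<inter> U" "open (T \<inter> U)"
        using T U K by (auto simp: E_def)
      then obtain \<epsilon> where \<epsilon>: "\<epsilon> > 0" "(\<Union>y\<in>K. ball y \<epsilon>) \<subseteq> T \<inter> U"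
        using compact_subset_open_imp_ball_epsilon_subset[OF \<open>compact K\<close>] by blast
      have \<epsilon>_ball: "w \<in> T \<inter> U" if "z \<in> K" "dist z w < \<epsilon>" for z w
      proof -
        have "w \<in> (\<Union>y\<in>K. ball y \<epsilon>)"
          using that by (intro UN_I[of z]) simp_all
        with \<epsilon>(2) show ?thesis
          by blast
      qed
      \<comment> \<open>Cells of generation \<open>k\<close> have diameter below
        \<open>\<epsilon> / 2\<close>; the other half of \<open>\<epsilon>\<close> is reserved for
        the radii.\<close>
      obtain k where "2 * ?d / \<epsilon> < 2 ^ k"
        using real_arch_pow[of 2] by auto
      then have k: "?d / 2 ^ k < \<epsilon> / 2"
        using \<epsilon>(1) by (simp add: field_simps)
      \<comment> \<open>\<open>F\<close> labels the cells meeting \<open>K\<close>, and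
        \<open>W\<close> is their union. \<open>W \<subseteq> U\<close> makes \<open>occ\<close>
        applicable, and nearness to \<open>K\<close> keeps the balls centred in \<open>W\<close>
        inside \<open>T\<close>.\<close>
      define F where "F = grid k ` K"
      define W where "W = grid k -` F"
      have F: "finite F" "F \<subseteq> range (grid k)"
        using \<open>compact K\<close> by (auto simp: F_def finite_grid_image compact_imp_bounded)
      have KW: "K \<subseteq> W"
        by (auto simp: W_def F_def)
      have W_near: "\<exists>z\<in>K. dist z w < \<epsilon> / 2" if "w \<in> W" for w
      proof -
        obtain z where z: "z \<in> K" "grid k z = grid k w"
          using \<open>w \<in> W\<close> by (auto simp: W_def F_def)
        have "norm (z - w) < \<epsilon> / 2"
          using grid_eq_imp_norm_le[OF z(2)] k by linarith
        with z(1) show ?thesis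
          unfolding dist_norm by blast
      qed
      have WU: "W \<subseteq> T \<inter> U"
      proof
        fix w assume "w \<in> W"
        then obtain z where "z \<in> K" "dist z w < \<epsilon>"
          using W_near \<epsilon>(1) by fastforce
        then show "w \<in> T \<inter> U"
          by (rule \<epsilon>_ball)
      qed
      define l where "l = measure lborel W"
      have W_borel: "W \<in> sets borel"
        unfolding W_def by (rule grid_vimage_borel[OF F(1)])
      have Kl: "measure lebesgue K \<le> l"
      proof -
        have "W \<in> lmeasurable"
          using W_borel bounded_grid_vimage[OF F(1), of k]
          by (intro bounded_set_imp_lmeasurable) (auto simp: W_def)
        then have "measure lebesgue K \<le> measure lebesgue W"
          using KW K_meas by (intro measure_mono_fmeasurable) (auto dest: fmeasurableD)
        then show ?thesis
          using W_borel by (simp add: l_def)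
      qed
      define Q where "Q j = x ` {..<m j} \<inter> W" for j
      have "eventually (\<lambda>j. card (grid j ` W) \<le> 2 * card (grid j ` Q j)) sequentially"
        using occ[OF F] WU unfolding Q_def m_def W_def by auto
      moreover have "(\<lambda>j. A * \<rho> j) \<longlonglongrightarrow> 0"
        using tendsto_mult_right_zero[OF \<rho>_lim] .
      then have "eventually (\<lambda>j. A * \<rho> j < \<epsilon> / 2) sequentially"
        using \<epsilon>(1) by (intro order_tendstoD) auto
      ultimately have "eventually (\<lambda>j. card (grid j ` W) \<le> 2 * card (grid j ` Q j) \<and> A * \<rho> j < \<epsilon> / 2
          \<and> k \<le> j \<and> i \<le> j) sequentially"
        using eventually_ge_at_top[of k] eventually_ge_at_top[of i] by eventually_elim auto
      then obtain j1 where j1: "\<And>j. j \<ge> j1 \<Longrightarrow> card (grid j ` W) \<le> 2 * card (grid j ` Q j)"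
          "\<And>j. j \<ge> j1 \<Longrightarrow> A * \<rho> j < \<epsilon> / 2" "\<And>j. j \<ge> j1 \<Longrightarrow> k \<le> j" "\<And>j. j \<ge> j1 \<Longrightarrow> i \<le> j"
        unfolding eventually_sequentially by metis
      \<comment> \<open>The series still diverges after its first \<open>j1\<close> terms are
        dropped, so a finite stretch of generations already has sum at least 1.\<close>
      obtain n where n: "(\<Sum>j=j1..n. \<beta> j * \<rho> j ^ ?d) \<ge> 1"
      proof (rule ccontr)
        let ?g = "\<lambda>j. \<beta> j * \<rho> j ^ ?d"
        assume "\<not> thesis"
        with that have lt: "(\<Sum>j=j1..n. ?g j) < 1" for n
          by (meson not_le)
        have g0: "0 \<le> ?g j" for j
          using \<rho>(2)[of j] by (simp add: \<beta>_def)
        have "summable ?g"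
        proof (rule summableI_nonneg_bounded)
          show "sum ?g {..<n} \<le> sum ?g {..<j1} + 1" for n
          proof -
            have "sum ?g {..<n} \<le> sum ?g ({..<j1} \<union> {j1..n})"
              using g0 by (intro sum_mono2) auto
            also have "\<dots> = sum ?g {..<j1} + sum ?g {j1..n}"
              by (intro sum.union_disjoint) auto
            finally show ?thesis
              using lt[of n] by linarith
          qed
        qed (rule g0)
        with div show False ..
      qed
      \<comment> \<open>Select one point from each occupied cell: \<open>P j\<close> meets the same
        cells as \<open>Q j\<close> but is injective on labels.\<close>
      have "\<exists>P. P \<subseteq> Q j \<and> inj_on (grid j) P \<and> grid j ` Q j = grid j ` P" for j
        using subset_image_inj[of "grid j ` Q j" "grid j" "Q j"] by simp
      then obtain P where P: "\<And>j. P j \<subseteq> Q j" "\<And>j. inj_on (grid j) (P j)"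
          "\<And>j. grid j ` Q j = grid j ` P j"
        by metis
      have card_P: "card (P j) = card (grid j ` Q j)" for j
        using P(2,3)[of j] by (simp add: card_image)
      have card_W: "card (grid j ` W) = l * \<beta> j" if "j \<ge> k" for j
        unfolding W_def l_def \<beta>_def by (rule grid_vimage_card[OF that F(1)])
      have fin_gW: "finite (grid j ` W)" for j
        unfolding W_def by (intro finite_grid_image bounded_grid_vimage F)
      let ?Y = "\<Union>j\<in>{j1..n}. \<Union>p\<in>P j. nball N p (\<rho> j)"
      have "l * \<omega> \<le> D * measure lborel ?Y"
        unfolding \<omega>_def D_def
      proof (rule measure_Union_nball_ge[OF N A, where \<rho> = \<rho>])
        fix j assume j: "j \<in> {j1..n}"
        show "finite (P j)"
          using P(1)[of j] by (rule finite_subset) (simp add: Q_def)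
        show "inj_on (grid j) (P j)"
          by (rule P(2))
        show "l * (2 ^ j) ^ ?d \<le> real (2 * card (P j))"
          using j1(1,3)[of j] card_W[of j] j unfolding card_P \<beta>_def
          by (metis atLeastAtMost_iff of_nat_le_iff)
        have "card (P j) \<le> card (grid j ` W)"
          unfolding card_P using fin_gW by (intro card_mono image_mono) (auto simp: Q_def)
        then show "real (card (P j)) \<le> l * (2 ^ j) ^ ?d"
          using card_W[of j] j1(3)[of j] j unfolding \<beta>_def
          by (metis atLeastAtMost_iff of_nat_le_iff)
      qed (use \<rho> n in \<open>auto simp: \<beta>_def\<close>)
      also have "measure lborel ?Y \<le> measure lebesgue (T - K)"
      proof -
        have Y_open: "open ?Y"
          by (intro open_UN ballI open_nball[OF N])
        \<comment> \<open>Each centre is within \<open>\<epsilon> / 2\<close> of \<open>K\<close>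
          and each ball has Euclidean radius below \<open>\<epsilon> / 2\<close>, so the balls stay
          in \<open>T\<close>. As \<open>j \<ge> i\<close> they lie in \<open>R i\<close>, which is
          disjoint from \<open>K\<close>.\<close>
        have "?Y \<subseteq> T - K"
        proof
          fix y assume "y \<in> ?Y"
          then obtain j p where j: "j \<in> {j1..n}" and p: "p \<in> P j" and y: "y \<in> nball N p (\<rho> j)"
            by auto
          from p P(1) have "p \<in> Q j"
            by auto
          then obtain n where n: "n < m j" "p = x n" and "p \<in> W"
            by (auto simp: Q_def)
          then obtain z where z: "z \<in> K" "dist z p < \<epsilon> / 2"
            using W_near by blast
          have "A * N (y - p) \<le> A * \<rho> j"
            using y A(1) by (intro mult_left_mono) (auto simp: nball_def)
          then have "dist p y < \<epsilon> / 2"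
            using A(2)[of "y - p"] j1(2)[of j] j by (simp add: dist_norm norm_minus_commute)
          with z(2) have "dist z y < \<epsilon>"
            using dist_triangle[of z y p] by linarith
          with z(1) \<epsilon>_ball have "y \<in> T"
            by blast
          moreover have "y \<in> R i"
            unfolding R_def using y n j j1(4)[of j] by auto
          with K(2) have "y \<notin> K"
            by (auto simp: E_def)
          ultimately show "y \<in> T - K"
            by simp
        qed
        with Y_open T(3) have "measure lebesgue ?Y \<le> measure lebesgue (T - K)"
          by (intro measure_mono_fmeasurable) auto
        with Y_open show ?thesis
          by simp
      qed
      finally have "l * \<omega> \<le> D * measure lebesgue (T - K)"
        using D by simp
      also have "\<dots> < D * (\<omega> / D * measure lebesgue K)"
        using TK D by (intro mult_strict_left_mono)
      also have "\<dots> = \<omega> * measure lebesgue K"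
        using D by simp
      also have "\<dots> \<le> l * \<omega>"
        using Kl \<omega> by (simp add: mult.commute)
      finally show False
        by simp
    qed
    then have "emeasure lebesgue E = 0"
      using E by (simp add: emeasure_eq_measure2)
    then show ?thesis
      using E_borel unfolding E_def by (auto simp: null_sets_def)
  qed

  \<comment> \<open>From hits in arbitrarily late generations to infinitely many hits\<close>
  have "(\<Union>i. U - R i) \<union> range x \<in> null_sets lborel"
    by (intro null_sets.Un null_sets_UN null countable_imp_null_set_lborel countable_image) auto
  then have "AE y in lborel. y \<notin> (\<Union>i. U - R i) \<union> range x"
    by (rule AE_not_in)
  then have "AE y in lborel. y \<in> U \<longrightarrow> (\<exists>\<^sub>\<infinity>n. N (y - x n) < r n)"
  proof eventually_elim
    fix y assume y: "y \<notin> (\<Union>i. U - R i) \<union> range x"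
    show "y \<in> U \<longrightarrow> (\<exists>\<^sub>\<infinity>n. N (y - x n) < r n)"
      unfolding INFM_iff_infinite
    proof (intro impI notI)
      assume "y \<in> U" and fin: "finite {n. N (y - x n) < r n}"
      \<comment> \<open>With finitely many hits, \<open>\<delta>\<close> bounds their distances from
        below; the element \<open>1\<close> keeps the set nonempty. It is positive because
        \<open>range x\<close> is excluded: at distance 0 a single index could serve every
        generation. A generation with \<open>\<rho> j < \<delta>\<close> then yields a hit closer
        than \<open>\<delta>\<close>, a contradiction.\<close>
      define \<delta> where "\<delta> = Min (insert 1 ((\<lambda>n. N (y - x n)) ` {n. N (y - x n) < r n}))"
      have "N (y - x n) > 0" for n
        using N y unfolding is_norm_fun_def by (metis UnCI eq_iff_diff_eq_0 less_eq_real_def rangeI)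
      then have "\<delta> > 0"
        using fin by (auto simp: \<delta>_def Min_gr_iff)
      then obtain i where i: "\<And>j. j \<ge> i \<Longrightarrow> \<rho> j < \<delta>"
        using order_tendstoD(2)[OF \<rho>_lim] by (auto simp: eventually_sequentially)
      have "y \<in> R i"
        using y \<open>y \<in> U\<close> by auto
      then obtain j n where jn: "j \<ge> i" "n < m j" "N (y - x n) < \<rho> j"
        by (auto simp: R_def nball_def)
      have "\<rho> j \<le> r n"
        unfolding \<rho>_def using jn(2) by (intro antimonoD[OF r(1)]) simp
      then have "\<delta> \<le> N (y - x n)"
        unfolding \<delta>_def using fin jn(3) by (intro Min_le) auto
      with i[OF jn(1)] jn(3) show False
        by simp
    qed
  qed
  then show "AE y in lebesgue. y \<in> U \<longrightarrow> (\<exists>\<^sub>\<infinity>n. N (y - x n) < r n)"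
    by (rule AE_completion)
qed

subsection \<open>Random points occupy the cells\<close>

text \<open>Independence makes the joint avoidance probability a product of equal single-point
  probabilities, each read off from the uniform law.\<close>

lemma (in prob_space) prob_avoid:
  fixes X :: "nat \<Rightarrow> 'a \<Rightarrow> 'b::euclidean_space"
  assumes indep: "indep_vars (\<lambda>_. borel) X UNIV"
    and distr: "\<And>n. distr M borel (X n) = uniform_measure lborel U"
    and U: "U \<in> sets borel" "emeasure lborel U \<noteq> 0" "emeasure lborel U \<noteq> \<infinity>"
    and B: "B \<in> sets borel" "B \<subseteq> U"
  shows "{\<omega> \<in> space M. \<forall>n<m. X n \<omega> \<notin> B} \<in> events"
    and "prob {\<omega> \<in> space M. \<forall>n<m. X n \<omega> \<notin> B} = (1 - measure lborel B / measure lborel U) ^ m"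
proof -
  have X [measurable]: "random_variable borel (X n)" for n
    using indep by (auto simp: indep_vars_def2)
  note [measurable] = B(1)
  show "{\<omega> \<in> space M. \<forall>n<m. X n \<omega> \<notin> B} \<in> events"
    by measurable
  have UL: "U \<in> fmeasurable lborel"
    using U by (auto simp: fmeasurable_def top.not_eq_extremum)
  have U0: "measure lborel U \<noteq> 0"
    using U by (simp add: measure_def enn2real_eq_0_iff)
  have single: "prob (X n -` (- B) \<inter> space M) = 1 - measure lborel B / measure lborel U" for n
  proof -
    have "prob (X n -` (- B) \<inter> space M) = measure (uniform_measure lborel U) (- B)"
      unfolding distr[symmetric, of n] using B by (subst measure_distr) auto
    also have "\<dots> = measure lborel (U \<inter> - B) / measure lborel U"
      using U B by (intro measure_uniform_measure) auto
    also have "U \<inter> - B = U - B"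
      by auto
    also have "measure lborel (U - B) = measure lborel U - measure lborel B"
      using UL B by (intro measurable_measure_Diff) auto
    finally show ?thesis
      using U0 by (simp add: diff_divide_distrib)
  qed
  show "prob {\<omega> \<in> space M. \<forall>n<m. X n \<omega> \<notin> B} = (1 - measure lborel B / measure lborel U) ^ m"
  \<comment> \<open>An intersection over no indices is the whole type rather than
    \<open>space M\<close>, and the product rule for independent sets needs a nonempty index
    set.\<close>
  proof (cases "m = 0")
    case True
    then show ?thesis
      by (simp add: prob_space)
  next
    case False
    have "{\<omega> \<in> space M. \<forall>n<m. X n \<omega> \<notin> B} = (\<Inter>n\<in>{..<m}. X n -` (- B) \<inter> space M)"
      using False by auto
    also have "prob \<dots> = (\<Prod>n<m. prob (X n -` (- B) \<inter> space M))"
    proof (rule indep_setsD)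
      show "indep_sets (\<lambda>i. {X i -` A \<inter> space M |A. A \<in> sets borel}) UNIV"
        using indep by (auto simp: indep_vars_def2)
      show "\<forall>j\<in>{..<m}. X j -` (- B) \<inter> space M \<in> {X j -` A \<inter> space M |A. A \<in> sets borel}"
        using B(1) by (auto intro!: exI[of _ "- B"])
    qed (use False in auto)
    finally show ?thesis
      by (simp add: single)
  qed
qed

text \<open>The first \<open>C * 2 ^ (j * d)\<close> points all avoid a given half of the cells with probability at most
  \<open>exp (- 2 \<kappa>)\<close>, where \<open>\<kappa>\<close> is the number of cells; this beats the \<open>2 ^ \<kappa>\<close> choices of the half.\<close>
lemma (in prob_space) AE_half_occupied:
  fixes X :: "nat \<Rightarrow> 'a \<Rightarrow> 'b::euclidean_space"
  assumes indep: "indep_vars (\<lambda>_. borel) X UNIV"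
    and distr: "\<And>n. distr M borel (X n) = uniform_measure lborel U"
    and U: "U \<in> sets borel" "emeasure lborel U \<noteq> 0" "emeasure lborel U \<noteq> \<infinity>"
    and F: "finite F" "grid k -` F \<subseteq> U"
    and C: "real C \<ge> 4 * measure lborel U"
  shows "AE \<omega> in M. eventually (\<lambda>j. card (grid j ` (grid k -` F)) \<le>
    2 * card (grid j ` ((\<lambda>n. X n \<omega>) ` {..<C * (2 ^ DIM('b)) ^ j} \<inter> grid k -` F))) sequentially"
proof (cases "grid k -` F = {}")
  case True
  then show ?thesis by simp
next
  case False
  let ?d = "DIM('b)"
  define W where "W = grid k -` F"
  define \<beta> :: "nat \<Rightarrow> real" where "\<beta> j = (2 ^ j) ^ ?d" for j
  define m where "m j = C * (2 ^ ?d) ^ j" for j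
  define \<kappa> where "\<kappa> j = card (grid j ` W)" for j
  define L where "L = measure lborel U"
  define avoid where "avoid j S = {\<omega> \<in> space M. \<forall>n<m j. X n \<omega> \<notin> W - grid j -` S}" for j S
  \<comment> \<open>\<open>S\<close> ranges over the possible sets of occupied labels with at most
    half of the cells. If fewer than half are occupied, the actual set of occupied labels is such an
    \<open>S\<close> and the points avoid all other cells of \<open>W\<close>, so this failure lies
    in \<open>bad j\<close>.\<close>
  define \<F> where "\<F> j = {S. S \<subseteq> grid j ` W \<and> 2 * card S \<le> \<kappa> j}" for j
  define bad where "bad j = (\<Union>S\<in>\<F> j. avoid j S)" for j
  have m: "real (m j) = C * \<beta> j" for j
    by (simp add: m_def \<beta>_def mult.commute flip: power_mult)
  have \<beta>: "\<beta> j > 0" for j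
    by (simp add: \<beta>_def)
  have L: "L > 0"
    using U by (simp add: L_def measure_def enn2real_positive_iff top.not_eq_extremum zero_less_iff_neq_zero)
  have fin_gW: "finite (grid j ` W)" for j
    unfolding W_def by (intro finite_grid_image bounded_grid_vimage F)
  have \<kappa>: "real (\<kappa> j) = measure lborel W * \<beta> j" if "j \<ge> k" for j
    unfolding \<kappa>_def W_def \<beta>_def by (rule grid_vimage_card[OF that F(1)])
  have fin_\<F>: "finite (\<F> j)" for j
    using fin_gW[of j] by (auto simp: \<F>_def)
  have finite_S: "finite S" if "S \<in> \<F> j" for S j
    using that fin_gW[of j] by (auto simp: \<F>_def intro: finite_subset)
  have W_borel: "W \<in> sets borel"
    unfolding W_def by (rule grid_vimage_borel[OF F(1)])
  have B: "W - grid j -` S \<in> sets borel" "W - grid j -` S \<subseteq> U" if "S \<in> \<F> j" for S j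
    using W_borel F(2) grid_vimage_borel[OF finite_S[OF that]] by (auto simp: W_def)
  have avoid_meas: "avoid j S \<in> events" if "S \<in> \<F> j" for S j
    unfolding avoid_def by (rule prob_avoid(1)[OF indep distr U B[OF that]])
  have avoid_le: "prob (avoid j S) \<le> exp (- 2 * real (\<kappa> j))" if S: "S \<in> \<F> j" and j: "j \<ge> k" for S j
  proof -
    let ?B = "W - grid j -` S"
    \<comment> \<open>For \<open>j \<ge> k\<close> the cells labelled by \<open>S\<close> lie wholly
      in \<open>W\<close>, so their volume subtracts exactly.\<close>
    have sub: "grid j -` S \<subseteq> W"
    proof -
      have "grid j -` S \<subseteq> grid j -` (grid j ` W)"
        using S by (intro vimage_mono) (auto simp: \<F>_def)
      then show ?thesis
        unfolding W_def grid_vimage_refine[OF j] .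
    qed
    have W_fm: "W \<in> fmeasurable lborel"
      using emeasure_bounded_finite[OF bounded_grid_vimage[OF F(1), of k]] W_borel
      by (simp add: fmeasurable_def W_def)
    have "measure lborel ?B = measure lborel W - measure lborel (grid j -` S)"
      using sub grid_vimage_borel[OF finite_S[OF S], of j] W_fm by (intro measurable_measure_Diff) auto
    also have "measure lborel (grid j -` S) = card S / \<beta> j"
      unfolding \<beta>_def using S finite_S[OF S] by (intro grid_vimage_measure) (auto simp: \<F>_def)
    also have "measure lborel W = \<kappa> j / \<beta> j"
      using \<kappa>[OF j] \<beta>[of j] by simp
    also have "\<kappa> j / \<beta> j - card S / \<beta> j = (\<kappa> j - real (card S)) / \<beta> j"
      by (simp add: diff_divide_distrib)
    also have "\<dots> \<ge> (\<kappa> j / 2) / \<beta> j"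
      using S \<beta>[of j] by (intro divide_right_mono) (auto simp: \<F>_def)
    finally have mB: "\<kappa> j / 2 / \<beta> j \<le> measure lborel ?B" .
    define t where "t = measure lborel ?B / L"
    have "t \<le> 1"
    proof -
      have "measure lborel ?B \<le> measure lborel U"
        using B[OF S] U by (intro measure_mono_fmeasurable) (auto simp: fmeasurable_def top.not_eq_extremum)
      then show ?thesis
        using L by (simp add: t_def L_def)
    qed
    \<comment> \<open>The cells outside \<open>S\<close> have volume at least
      \<open>\<kappa> j / (2 * \<beta> j)\<close>. With \<open>C * \<beta> j\<close> points and
      \<open>C \<ge> 4 * L\<close>, the expected number of points there is at least
      \<open>2 * \<kappa> j\<close>.\<close>
    have "2 * real (\<kappa> j) = \<kappa> j / 2 / \<beta> j / L * (4 * L * \<beta> j)"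
      using L \<beta>[of j] by simp
    also have "\<dots> \<le> t * (C * \<beta> j)"
      unfolding t_def using mB C L \<beta>[of j]
      by (intro mult_mono divide_right_mono) (auto simp: L_def)
    finally have tm: "2 * real (\<kappa> j) \<le> t * m j"
      by (simp add: m)
    have "prob (avoid j S) = (1 - t) ^ m j"
      unfolding avoid_def t_def L_def by (rule prob_avoid(2)[OF indep distr U B[OF S]])
    also have "\<dots> \<le> exp (- t) ^ m j"
      using exp_ge_add_one_self[of "- t"] \<open>t \<le> 1\<close> by (intro power_mono) auto
    also have "\<dots> = exp (- (t * m j))"
      by (simp add: mult.commute flip: exp_of_nat_mult)
    also have "\<dots> \<le> exp (- 2 * real (\<kappa> j))"
      using tm by simp
    finally show ?thesis .
  qed
  have bad_meas: "bad j \<in> events" for j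
    unfolding bad_def using fin_\<F> avoid_meas by (intro sets.finite_UN) auto
  have bad_le: "prob (bad j) \<le> exp (- real (\<kappa> j))" if j: "j \<ge> k" for j
  proof -
    have "prob (bad j) \<le> (\<Sum>S\<in>\<F> j. prob (avoid j S))"
      unfolding bad_def using fin_\<F> avoid_meas by (intro finite_measure_subadditive_finite) auto
    also have "\<dots> \<le> (\<Sum>S\<in>\<F> j. exp (- 2 * real (\<kappa> j)))"
      by (intro sum_mono avoid_le j)
    also have "\<dots> = card (\<F> j) * exp (- 2 * real (\<kappa> j))"
      by simp
    also have "real (card (\<F> j)) \<le> 2 ^ \<kappa> j"
    proof -
      have "card (\<F> j) \<le> card (Pow (grid j ` W))"
        using fin_gW by (intro card_mono) (auto simp: \<F>_def)
      then have "card (\<F> j) \<le> 2 ^ \<kappa> j"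
        using fin_gW by (simp add: card_Pow \<kappa>_def)
      then show ?thesis
        by (metis of_nat_le_iff of_nat_numeral of_nat_power)
    qed
    \<comment> \<open>Bounding 2 by e, the number of choices of \<open>S\<close> uses up one of the
      two factors \<open>exp (- \<kappa> j)\<close>.\<close>
    also have "(2::real) ^ \<kappa> j \<le> exp 1 ^ \<kappa> j"
      using exp_ge_add_one_self[of 1] by (intro power_mono) auto
    also have "exp 1 ^ \<kappa> j * exp (- 2 * real (\<kappa> j)) = exp (- real (\<kappa> j))"
      by (simp flip: exp_of_nat_mult exp_add)
    finally show ?thesis
      by (simp add: mult_right_mono)
  qed
  \<comment> \<open>At least one cell exists in generation \<open>k\<close>, and each refinement
    multiplies the count by \<open>2 ^ ?d\<close>. Linear growth is enough to compare
    \<open>exp (- \<kappa> j)\<close> with a geometric series.\<close>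
  have \<kappa>_ge: "real j - real k \<le> \<kappa> j" if j: "j \<ge> k" for j
  proof -
    have "\<kappa> k > 0"
      using False fin_gW[of k] by (auto simp: \<kappa>_def W_def card_gt_0_iff)
    then have 1: "1 \<le> measure lborel W * \<beta> k"
      using \<kappa>[of k] by simp
    have "real j - real k \<le> 2 ^ (j - k)"
      using less_exp[of "j - k"] j by (metis of_nat_diff of_nat_le_iff of_nat_numeral of_nat_power less_imp_le)
    also have "\<dots> \<le> (2 ^ (j - k)) ^ ?d"
      by (intro self_le_power) auto
    also have "\<dots> \<le> (measure lborel W * \<beta> k) * (2 ^ (j - k)) ^ ?d"
      using mult_right_mono[OF 1, of "(2 ^ (j - k)) ^ ?d"] by simp
    also have "\<dots> = measure lborel W * \<beta> j"
      using j by (simp add: \<beta>_def flip: power_add power_mult_distrib)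
    finally show ?thesis
      by (simp add: \<kappa>[OF j])
  qed
  have "summable (\<lambda>j. prob (bad j))"
  proof (rule summable_comparison_test_ev)
    have "norm (prob (bad j)) \<le> exp (real k) * exp (- 1) ^ j" if "j \<ge> k" for j
    proof -
      have "prob (bad j) \<le> exp (real k - real j)"
        using bad_le[OF that] \<kappa>_ge[OF that] by (smt (verit) exp_le_cancel_iff)
      also have "\<dots> = exp (real k) * exp (- 1) ^ j"
        by (simp flip: exp_of_nat_mult exp_add)
      finally show ?thesis
        by simp
    qed
    then show "eventually (\<lambda>j. norm (prob (bad j)) \<le> exp (real k) * exp (- 1) ^ j) sequentially"
      by (rule eventually_sequentiallyI)
    show "summable (\<lambda>j. exp (real k) * exp (- 1 :: real) ^ j)"
      by (intro summable_mult summable_geometric) simp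
  qed
  then have "AE \<omega> in M. eventually (\<lambda>j. \<omega> \<in> space M - bad j) sequentially"
    using bad_meas by (intro borel_cantelli_AE1) (auto simp: less_top[symmetric])
  then show ?thesis
  proof eventually_elim
    fix \<omega> assume "eventually (\<lambda>j. \<omega> \<in> space M - bad j) sequentially"
    then show "eventually (\<lambda>j. card (grid j ` (grid k -` F)) \<le>
        2 * card (grid j ` ((\<lambda>n. X n \<omega>) ` {..<C * (2 ^ DIM('b)) ^ j} \<inter> grid k -` F))) sequentially"
    proof eventually_elim
      fix j assume \<omega>: "\<omega> \<in> space M - bad j"
      define S where "S = grid j ` ((\<lambda>n. X n \<omega>) ` {..<m j} \<inter> W)"
      have "\<kappa> j \<le> 2 * card S"
      proof (rule ccontr)
        assume "\<not> \<kappa> j \<le> 2 * card S"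
        then have "S \<in> \<F> j"
          by (auto simp: \<F>_def S_def)
        moreover have "\<omega> \<in> avoid j S"
          using \<omega> by (auto simp: avoid_def S_def)
        ultimately show False
          using \<omega> by (auto simp: bad_def)
      qed
      then show "card (grid j ` (grid k -` F)) \<le>
          2 * card (grid j ` ((\<lambda>n. X n \<omega>) ` {..<C * (2 ^ DIM('b)) ^ j} \<inter> grid k -` F))"
        by (simp add: \<kappa>_def S_def m_def W_def)
    qed
  qed
qed

theorem theorem13p1:
  fixes N :: "'a::euclidean_space \<Rightarrow> real"
    and U :: "'a set"
    and M :: "'w measure"
    and X :: "nat \<Rightarrow> 'w \<Rightarrow> 'a"
  assumes "is_norm_fun N"
    and "U \<noteq> {}" and "bounded U" and "open U"
    and "prob_space M"
    and "prob_space.indep_vars M (\<lambda>_. borel) X UNIV"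
    and "\<And>n. distr M borel (X n) = uniform_measure lborel U"
  shows "AE \<omega> in M. uniformly_eutaxic N U (\<lambda>n. X n \<omega>)"
proof -
  interpret prob_space M by fact
  have U: "U \<in> sets borel" "emeasure lborel U \<noteq> \<infinity>" "emeasure lborel U \<noteq> 0"
  proof -
    show "U \<in> sets borel" "emeasure lborel U \<noteq> \<infinity>"
      using \<open>open U\<close> emeasure_bounded_finite[OF \<open>bounded U\<close>] by auto
    show "emeasure lborel U \<noteq> 0"
      using open_not_negligible[OF \<open>open U\<close> \<open>U \<noteq> {}\<close>] \<open>open U\<close>
      by (auto simp: negligible_iff_null_sets null_sets_def)
  qed
  \<comment> \<open>\<open>C\<close> depends on \<open>U\<close> alone, so the same numbers of
    points serve every union of cells.\<close>
  obtain C :: nat where C: "C \<ge> 1" "real C \<ge> 4 * measure lborel U"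
    using real_arch_simple[of "max 1 (4 * measure lborel U)"] by auto
  \<comment> \<open>There are countably many finite sets of labels, so one null event covers all of
    them. The uncountably many radius sequences enter only afterwards, through the deterministic
    criterion.\<close>
  define \<F> where "\<F> k = {F. finite F \<and> F \<subseteq> range (grid k) \<and> grid k -` F \<subseteq> U}" for k
  have "countable (\<F> k)" for k
    using countable_Collect_finite_subset[OF countable_range_grid[of k]]
    by (rule countable_subset[rotated]) (auto simp: \<F>_def)
  then have "AE \<omega> in M. \<forall>k. \<forall>F\<in>\<F> k. eventually (\<lambda>j. card (grid j ` (grid k -` F)) \<le>
      2 * card (grid j ` ((\<lambda>n. X n \<omega>) ` {..<C * (2 ^ DIM('a)) ^ j} \<inter> grid k -` F))) sequentially"
    by (intro AE_all_countable[THEN iffD2] allI AE_ball_countable[THEN iffD2] ballI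
        AE_half_occupied[OF assms(6,7) U(1,3,2) _ _ C(2)]) (auto simp: \<F>_def)
  then show ?thesis
  proof eventually_elim
    fix \<omega> assume "\<forall>k. \<forall>F\<in>\<F> k. eventually (\<lambda>j. card (grid j ` (grid k -` F)) \<le>
      2 * card (grid j ` ((\<lambda>n. X n \<omega>) ` {..<C * (2 ^ DIM('a)) ^ j} \<inter> grid k -` F))) sequentially"
    then show "uniformly_eutaxic N U (\<lambda>n. X n \<omega>)"
      by (intro uniformly_eutaxic_if_half_occupied[OF assms(1,4,3) C(1)]) (auto simp: \<F>_def)
  qed
qed

end
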